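(* There are absolute constants $0<c<C$ such that for every integer $L\ge 4$ there are finite sets $A,B,F,G\subset\mathbb{Q}_{>0}$ with $|A|=|B|=m$, where $m=L^2$, and $|AF|,|BG|,|AB|\le t$, where $t=4L^3$, such that $$c\,m\left(\frac tm\right)^8\ \le\ \left|\frac{F^{(2)}G^{(2)}}{F^{(2)}G}\right|\ \le\ C\,m\left(\frac tm\right)^8 .$$ Consequently, there are no $\delta>0$ and $K>0$ such that $$\left|\frac{F^{(2)}G^{(2)}}{F^{(2)}G}\right|\le K\,m\left(\frac tm\right)^{8-\delta}$$ holds for all finite nonempty $A,B,F,G\subset\mathbb{Q}_{>0}$ and all reals $t\ge m\ge1$ satisfying $|AF|,|BG|,|AB|\le t$ and $|A|,|B|\ge m$.
   Context: Product sets: $UV=\{uv:u\in U,v\in V\}$; quotient sets: $U/V=\{u/v:u\in U,v\in V\}$; $F^{(j)}=\{f_1\cdots f_j:f_i\in F\}$ is the $j$-fold product set with independent choices of the factors. *)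

theory Defs
  imports Complex_Main "HOL-Library.Set_Algebras"
begin

text \<open>
  The product set \<open>UV\<close> is \<open>U * V\<close>, and the \<open>j\<close>-fold product set \<open>F\<close> with exponent \<open>(j)\<close> is
  \<open>F ^ j\<close>, both with the elementwise operations of \<open>Set_Algebras\<close>; in particular \<open>F ^ j\<close> is
  not the set of \<open>j\<close>-th powers of elements of \<open>F\<close>:
\<close>

lemma set_power_two_eq:
  fixes F :: "'a::comm_monoid_mult set"
  shows "F ^ 2 = {f\<^sub>1 * f\<^sub>2 | f\<^sub>1 f\<^sub>2. f\<^sub>1 \<in> F \<and> f\<^sub>2 \<in> F}"
  by (auto simp: power2_eq_square set_times_def)

definition quotient_set :: "'a::field set \<Rightarrow> 'a set \<Rightarrow> 'a set" where
  "quotient_set U V = {u / v | u v. u \<in> U \<and> v \<in> V}"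

end

theory Submission
  imports Defs
begin

text \<open>
  All sets consist of powers of 2, so the multiplicative problem is an additive one in the
  integers. Take exponents \<open>A = {0..<L\<^sup>2}\<close>, \<open>B = L \<cdot> {0..<L\<^sup>2}\<close>, \<open>F = A + X\<close>, \<open>G = B + Y\<close>, where
  \<open>X\<close> and \<open>Y\<close> are unions of four and three arithmetic progressions of length \<open>q = \<lfloor>L/4\<rfloor>\<close>.
  The set \<open>2F + 2G - 2F - G\<close> is covered by \<open>O(L\<^sup>7)\<close> translates of an interval of length \<open>O(L\<^sup>3)\<close>.
  The steps of the progressions are \<open>L\<^sup>3, L\<^sup>3q, \<dots>, L\<^sup>3q\<^sup>6\<close> up to sign, so one summand from each,
  together with \<open>A + B \<supseteq> {0..<L\<^sup>3}\<close>, yields the mixed radix expansion of every number below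
  \<open>L\<^sup>3q\<^sup>7\<close>.
\<close>

section \<open>Sumsets and their images under integer powers of a fixed base\<close>

lemma card_set_plus_le:
  fixes S T :: "'a::plus set"
  assumes "finite S" "finite T"
  shows "card (S + T) \<le> card S * card T"
proof -
  have "S + T = (\<lambda>(s, t). s + t) ` (S \<times> T)"
    by (auto simp: set_plus_def)
  then show ?thesis
    using card_image_le[of "S \<times> T" "\<lambda>(s, t). s + t"] assms by (simp add: card_cartesian_product)
qed

lemma uminus_image_set_plus:
  fixes S T :: "'a::ab_group_add set"
  shows "uminus ` (S + T) = uminus ` S + uminus ` T"
  by (simp add: set_plus_image image_image case_prod_beta flip: image_paired_Times)

lemma powi_image_plus:
  fixes a :: "'a::field"
  assumes "a \<noteq> 0"
  shows "(\<lambda>k. a powi k) ` (S + T) = (\<lambda>k. a powi k) ` S * (\<lambda>k. a powi k) ` T"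
  using assms
  by (simp add: set_plus_image set_times_image image_image case_prod_beta power_int_add
      flip: image_paired_Times)

lemma quotient_set_powi_image:
  fixes a :: "'a::field"
  assumes "a \<noteq> 0"
  shows "quotient_set ((\<lambda>k. a powi k) ` S) ((\<lambda>k. a powi k) ` T)
       = (\<lambda>k. a powi k) ` (S + uminus ` T)"
proof -
  have quot: "quotient_set U V = (\<lambda>(u, v). u / v) ` (U \<times> V)" for U V :: "'a set"
    by (auto simp: quotient_set_def)
  have "S \<times> uminus ` T = (\<lambda>(s, t). (s, - t)) ` (S \<times> T)"
    using image_paired_Times[of "\<lambda>s. s" uminus S T] by simp
  then show ?thesis
    using assms
    by (simp add: quot set_plus_image image_image case_prod_beta power_int_diff
        flip: image_paired_Times)
qed

lemma inj_powi:
  fixes a :: "'a::linordered_field"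
  assumes "a > 1"
  shows "inj (\<lambda>k. a powi k)"
proof (rule linorder_injI)
  fix k l :: int
  assume "k < l"
  then show "a powi k \<noteq> a powi l"
    using power_int_strict_increasing[OF _ assms] by (metis less_irrefl)
qed

text \<open>Division with remainder by \<open>M\<close>: the interval holds the remainders, the
  progression the multiples of \<open>M\<close> by the quotients. Each use adds one digit to a mixed
  radix expansion.\<close>

lemma atLeastLessThan_add_mult_image:
  fixes M q :: int
  assumes "0 < M"
  shows "{0..<M} + (*) M ` {0..<q} = {0..<M * q}"
proof
  show "{0..<M * q} \<subseteq> {0..<M} + (*) M ` {0..<q}"
  proof
    fix n assume n: "n \<in> {0..<M * q}"
    have split: "n = n mod M + M * (n div M)" and r: "n mod M \<in> {0..<M}"
      using assms by simp_all
    then have "M * (n div M) < M * q"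
      using n unfolding atLeastLessThan_iff by linarith
    then have "n div M \<in> {0..<q}"
      using n assms by (simp add: pos_imp_zdiv_nonneg_iff)
    then show "n \<in> {0..<M} + (*) M ` {0..<q}"
      using split r by (metis imageI set_plus_intro)
  qed
  show "{0..<M} + (*) M ` {0..<q} \<subseteq> {0..<M * q}"
  proof
    fix n assume "n \<in> {0..<M} + (*) M ` {0..<q}"
    then obtain r d where rd: "n = r + M * d" "0 \<le> r" "r < M" "0 \<le> d" "d \<le> q - 1"
      by (auto simp: set_plus_def)
    then have "M * d \<le> M * (q - 1)" "0 \<le> M * d"
      using assms by (auto intro: mult_left_mono)
    then show "n \<in> {0..<M * q}"
      using rd by (simp add: algebra_simps)
  qed
qed

section \<open>The additive construction in the integers\<close>

lemma exists_exponent_sets: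
  fixes L :: nat
  assumes "L \<ge> 4"
  obtains A B F G :: "int set" where
    "finite A" "finite B" "finite F" "finite G"
    "card A = L ^ 2" "card B = L ^ 2"
    "card (A + F) \<le> 4 * L ^ 3" "card (B + G) \<le> 4 * L ^ 3" "card (A + B) \<le> 4 * L ^ 3"
    "L ^ 3 * (L div 4) ^ 7 \<le> card (F + F + (G + G) + uminus ` (F + F + G))"
    "card (F + F + (G + G) + uminus ` (F + F + G)) \<le> 5 * L ^ 10"
proof -
  define l where "l = int L"
  \<comment> \<open>With length \<open>L div 4\<close>, up to four progressions together have at
    most \<open>L\<close> elements; \<open>L \<ge> 4\<close> makes the length positive.\<close>
  define q where "q = int (L div 4)"
  define P where "P k = (*) k ` {0..<q}" for k :: int
  define M where "M i = l ^ 3 * q ^ i" for i :: nat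
  \<comment> \<open>In \<open>?D\<close>, the set \<open>F\<close> occurs twice with each sign,
    while \<open>G\<close> occurs twice with plus and once with minus. Each of these seven
    occurrences supplies one digit; a digit taken from a subtracted copy needs a progression with
    negative step.\<close>
  define X where "X = P (M 0) \<union> P (M 1) \<union> P (- M 2) \<union> P (- M 3)"
  define Y where "Y = P (M 4) \<union> P (M 5) \<union> P (- M 6)"
  define A where "A = {0..<l ^ 2}"
  \<comment> \<open>Dilating by \<open>l\<close> keeps \<open>B + B\<close> as small as
    \<open>A + A\<close>, while \<open>A + B\<close> still covers every residue and fills
    \<open>{0..<l ^ 3}\<close>.\<close>
  define B where "B = (*) l ` {0..<l ^ 2}"
  define F where "F = A + X"
  define G where "G = B + Y"
  let ?D = "F + F + (G + G) + uminus ` (F + F + G)"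
  have l: "l \<ge> 4" and q: "q > 0"
    using assms by (auto simp: l_def q_def)
  have finP: "finite (P k)" and cardP: "card (P k) \<le> L div 4" for k
    using card_image_le[of "{0..<q}" "(*) k"] by (auto simp: P_def q_def)
  have finX: "finite X" and finY: "finite Y"
    by (auto simp: X_def Y_def finP)
  have "card X \<le> card (P (M 0)) + card (P (M 1)) + card (P (- M 2)) + card (P (- M 3))"
    unfolding X_def by (meson card_Un_le le_trans add_le_mono order_refl)
  then have cardX: "card X \<le> L"
    using cardP[of "M 0"] cardP[of "M 1"] cardP[of "- M 2"] cardP[of "- M 3"] by linarith
  have "card Y \<le> card (P (M 4)) + card (P (M 5)) + card (P (- M 6))"
    unfolding Y_def by (meson card_Un_le le_trans add_le_mono order_refl)
  then have cardY: "card Y \<le> L"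
    using cardP[of "M 4"] cardP[of "M 5"] cardP[of "- M 6"] by linarith
  have finA: "finite A" and finB: "finite B"
    by (auto simp: A_def B_def)
  have finF: "finite F" and finG: "finite G"
    by (auto simp: F_def G_def finA finB finX finY intro: finite_set_plus)
  have cardA: "card A = L ^ 2"
    by (simp add: A_def l_def flip: of_nat_power)
  have cardB: "card B = L ^ 2"
    unfolding B_def using l cardA by (subst card_image) (auto simp: A_def inj_on_def)
  have cube: "l * l ^ 2 = l ^ 3"
    by (simp add: power3_eq_cube power2_eq_square)
  have sq_le: "4 * l ^ 2 \<le> l ^ 3"
    using mult_right_mono[OF l, of "l ^ 2"] cube by simp

  have "card (A + A) \<le> card {0..<2 * l ^ 2}"
    by (rule card_mono) (auto simp: A_def set_plus_def)
  then have AA: "card (A + A) \<le> 2 * L ^ 2"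
    by (simp add: l_def nat_mult_distrib nat_power_eq)
  have "B + B = (*) l ` (A + A)"
    by (fastforce simp: A_def B_def set_plus_def image_iff distrib_left)
  then have BB: "card (B + B) \<le> 2 * L ^ 2"
    using AA card_image_le[of "A + A" "(*) l"] finA by (simp add: finite_set_plus)
  \<comment> \<open>This is the shape of \<open>A + F\<close> and \<open>B + G\<close> after
    unfolding: small doubling of \<open>S\<close> leaves only one factor \<open>L\<close> for the
    progressions. The resulting \<open>2 * L ^ 3\<close> is relaxed to the common bound
    \<open>4 * L ^ 3\<close>.\<close>
  have twice: "card (S + (S + Z)) \<le> 4 * L ^ 3"
    if "finite S" "finite Z" "card (S + S) \<le> 2 * L ^ 2" "card Z \<le> L" for S Z :: "int set"
  proof -
    have "card (S + S + Z) \<le> card (S + S) * card Z"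
      using that by (intro card_set_plus_le finite_set_plus)
    also have "\<dots> \<le> (2 * L ^ 2) * L"
      using that by (intro mult_le_mono)
    finally show ?thesis
      by (simp add: power3_eq_cube power2_eq_square add.assoc)
  qed
  have AF: "card (A + F) \<le> 4 * L ^ 3" and BG: "card (B + G) \<le> 4 * L ^ 3"
    unfolding F_def G_def by (intro twice finA finB finX finY AA BB cardX cardY)+
  have B_bounds: "0 \<le> b" "b \<le> l ^ 3" if b: "b \<in> B" for b
  proof -
    obtain j where j: "j \<in> {0..<l ^ 2}" "b = l * j"
      using b unfolding B_def by blast
    then have "l * j \<le> l ^ 3"
      using l unfolding cube[symmetric] by (intro mult_left_mono) simp_all
    then show "0 \<le> b" "b \<le> l ^ 3"
      using l j by simp_all
  qed
  have A_bounds: "0 \<le> a" "a < l ^ 2" if "a \<in> A" for a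
    using that by (auto simp: A_def)
  have "A + B \<subseteq> {0..<4 * l ^ 3}"
  proof
    fix n assume "n \<in> A + B"
    then obtain a b where ab: "n = a + b" "a \<in> A" "b \<in> B"
      by (auto simp: set_plus_def)
    then show "n \<in> {0..<4 * l ^ 3}"
      using A_bounds[of a] B_bounds[of b] sq_le by simp
  qed
  then have "card (A + B) \<le> card {0..<4 * l ^ 3}"
    by (rule card_mono[rotated]) simp
  then have AB: "card (A + B) \<le> 4 * L ^ 3"
    by (simp add: l_def nat_mult_distrib nat_power_eq)

  \<comment> \<open>Upper bound: \<open>?I\<close> gathers the contributions of \<open>A\<close> and
    \<open>B\<close> to the seven summands, \<open>?Z\<close> those of \<open>X\<close> and
    \<open>Y\<close>. The first lies in one interval of length \<open>O(l ^ 3)\<close>, the second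
    has at most \<open>L ^ 7\<close> elements.\<close>
  let ?I = "A + A + (B + B) + uminus ` (A + A + B)"
  let ?Z = "X + X + (Y + Y) + uminus ` (X + X + Y)"
  \<comment> \<open>The lower end comes from \<open>a3 + a4 + b3 < 2 * l ^ 2 + l ^ 3\<close>, with
    the square absorbed by \<open>sq_le\<close>; the upper end from two elements of each of
    \<open>A\<close> and \<open>B\<close>.\<close>
  have "?I \<subseteq> {- 2 * l ^ 3..<2 * l ^ 3 + 2 * l ^ 2}"
  proof
    fix n assume "n \<in> ?I"
    then obtain a1 a2 b1 b2 a3 a4 b3 where n: "n = a1 + a2 + (b1 + b2) + - (a3 + a4 + b3)"
      and mem: "a1 \<in> A" "a2 \<in> A" "a3 \<in> A" "a4 \<in> A" "b1 \<in> B" "b2 \<in> B" "b3 \<in> B"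
      by (elim set_plus_elim imageE) blast
    show "n \<in> {- 2 * l ^ 3..<2 * l ^ 3 + 2 * l ^ 2}"
      using mem(1-4)[THEN A_bounds(1)] mem(1-4)[THEN A_bounds(2)]
        mem(5-7)[THEN B_bounds(1)] mem(5-7)[THEN B_bounds(2)] sq_le
      unfolding n by simp
  qed
  then have "card ?I \<le> card {- 2 * l ^ 3..<2 * l ^ 3 + 2 * l ^ 2}"
    by (rule card_mono[rotated]) simp
  also have "\<dots> \<le> nat (5 * l ^ 3)"
    using sq_le l by simp
  also have "\<dots> = 5 * L ^ 3"
    by (simp add: l_def nat_mult_distrib nat_power_eq)
  finally have cardI: "card ?I \<le> 5 * L ^ 3" .
  have plus: "card (S + T) \<le> i * j" if "finite S" "finite T" "card S \<le> i" "card T \<le> j"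
    for S T :: "int set" and i j
    using card_set_plus_le[OF that(1,2)] mult_le_mono[OF that(3,4)] by (rule le_trans)
  have minus: "card (uminus ` S) \<le> i" if "finite S" "card S \<le> i" for S :: "int set" and i
    using card_image_le[OF that(1)] that(2) by (rule le_trans)
  \<comment> \<open>The bracketing mirrors that of \<open>?Z\<close>, so that the rules
    \<open>plus\<close> and \<open>minus\<close> apply summand by summand.\<close>
  have cardZ: "card ?Z \<le> ((L * L) * (L * L)) * ((L * L) * L)"
    by (intro plus minus finite_set_plus finite_imageI finX finY cardX cardY)
  have D: "?D = ?I + ?Z"
    by (simp add: F_def G_def uminus_image_set_plus ac_simps)
  have "card ?D \<le> (5 * L ^ 3) * (((L * L) * (L * L)) * ((L * L) * L))"
    unfolding D by (intro plus finite_set_plus finite_imageI finA finB finX finY cardI cardZ)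
  also have "\<dots> = 5 * L ^ 10"
    by algebra
  finally have upper: "card ?D \<le> 5 * L ^ 10" .

  \<comment> \<open>Lower bound: adding a progression of step \<open>M i\<close> appends one base
    \<open>q\<close> digit.\<close>
  have step: "{0..<M i} + P (M i) = {0..<M (Suc i)}" for i
    unfolding P_def using l q
    by (subst atLeastLessThan_add_mult_image) (auto simp: M_def mult_ac)
  have neg: "P k \<subseteq> uminus ` S" if "P (- k) \<subseteq> S" for k S
    using that by (force simp: P_def image_iff)
  have zero: "0 \<in> A" "0 \<in> B"
    using l by (auto simp: A_def B_def image_iff)
  \<comment> \<open>The lowest part of the expansion: remainder modulo \<open>l ^ 2\<close> from
    \<open>A\<close>, and a multiple \<open>l ^ 2 * j = l * (l * j)\<close> with
    \<open>j < l\<close> from \<open>B\<close>.\<close>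
  have "{0..<M 0} = {0..<l ^ 2} + (*) (l ^ 2) ` {0..<l}"
    using l cube by (subst atLeastLessThan_add_mult_image) (auto simp: M_def mult.commute)
  also have "\<dots> \<subseteq> A + B"
  proof (rule set_plus_mono2)
    have "l ^ 2 * j = l * (l * j)" "l * j \<in> {0..<l ^ 2}" if "j \<in> {0..<l}" for j
      using that l by (auto simp: power2_eq_square)
    then show "(*) (l ^ 2) ` {0..<l} \<subseteq> B"
      unfolding B_def by (blast intro: image_eqI)
  qed (simp add: A_def)
  finally have base: "{0..<M 0} \<subseteq> A + B" .
  \<comment> \<open>The seven digit steps telescope. The digits \<open>M 2\<close>,
    \<open>M 3\<close> and \<open>M 6\<close> are then taken from the negated sets by
    \<open>neg\<close>.\<close>
  have "{0..<M 7} = {0..<M 0} + P (M 0) + P (M 1) + P (M 2) + P (M 3) + P (M 4) + P (M 5) + P (M 6)"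
    by (simp add: step eval_nat_numeral)
  also have "\<dots> \<subseteq> (A + B) + X + X + uminus ` X + uminus ` X + Y + Y + uminus ` Y"
    by (intro set_plus_mono2 base neg) (auto simp: X_def Y_def)
  \<comment> \<open>\<open>A\<close> and \<open>B\<close> are each used once, completing one copy of
    \<open>F\<close> and one of \<open>G\<close>. The other five summands embed by
    \<open>X \<subseteq> F\<close> and \<open>Y \<subseteq> G\<close>, as \<open>0\<close> lies in
    both \<open>A\<close> and \<open>B\<close>.\<close>
  also have "\<dots> = (A + X) + X + ((B + Y) + Y) + uminus ` (X + X + Y)"
    by (simp add: uminus_image_set_plus ac_simps)
  also have "\<dots> \<subseteq> ?D"
  proof -
    have "X \<subseteq> F" "Y \<subseteq> G"
      unfolding F_def G_def using zero by (force simp: set_plus_def)+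
    then show ?thesis
      by (intro set_plus_mono2 image_mono) (auto simp: F_def G_def)
  qed
  finally have "card {0..<M 7} \<le> card ?D"
    by (rule card_mono[rotated])
      (intro finite_set_plus finite_imageI finF finG)
  then have lower: "L ^ 3 * (L div 4) ^ 7 \<le> card ?D"
    by (simp add: M_def l_def q_def nat_mult_distrib nat_power_eq)
  show ?thesis
    by (rule that[OF finA finB finF finG cardA cardB AF BG AB lower upper])
qed

section \<open>Transfer to positive rationals and comparison with the eighth power\<close>

lemma exists_rat_sets:
  fixes L :: nat
  assumes "L \<ge> 4"
  obtains A B F G :: "rat set" where
    "finite A" "finite B" "finite F" "finite G"
    "A \<subseteq> {0<..}" "B \<subseteq> {0<..}" "F \<subseteq> {0<..}" "G \<subseteq> {0<..}"
    "card A = L ^ 2" "card B = L ^ 2"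
    "card (A * F) \<le> 4 * L ^ 3" "card (B * G) \<le> 4 * L ^ 3" "card (A * B) \<le> 4 * L ^ 3"
    "L ^ 3 * (L div 4) ^ 7 \<le> card (quotient_set (F ^ 2 * G ^ 2) (F ^ 2 * G))"
    "card (quotient_set (F ^ 2 * G ^ 2) (F ^ 2 * G)) \<le> 5 * L ^ 10"
proof -
  obtain A B F G :: "int set" where fin: "finite A" "finite B" "finite F" "finite G"
    and card: "card A = L ^ 2" "card B = L ^ 2"
      "card (A + F) \<le> 4 * L ^ 3" "card (B + G) \<le> 4 * L ^ 3" "card (A + B) \<le> 4 * L ^ 3"
      "L ^ 3 * (L div 4) ^ 7 \<le> card (F + F + (G + G) + uminus ` (F + F + G))"
      "card (F + F + (G + G) + uminus ` (F + F + G)) \<le> 5 * L ^ 10"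
    by (rule exists_exponent_sets[OF assms])
  \<comment> \<open>An injective homomorphism from the additive integers to the positive rationals:
    sums become products, differences become quotients, and cardinalities are preserved.\<close>
  let ?e = "\<lambda>k :: int. (2 :: rat) powi k"
  have card_e: "card (?e ` S) = card S" for S
    using inj_powi[of "2 :: rat"] by (intro card_image) (auto intro: inj_on_subset)
  have times: "?e ` S * ?e ` T = ?e ` (S + T)" for S T
    by (rule powi_image_plus[symmetric]) simp
  have quot: "quotient_set (?e ` S) (?e ` T) = ?e ` (S + uminus ` T)" for S T
    by (rule quotient_set_powi_image) simp
  show ?thesis
    by (rule that[of "?e ` A" "?e ` B" "?e ` F" "?e ` G"])
      (use fin card in \<open>auto simp: power2_eq_square times quot card_e\<close>)
qed

text \<open>Here \<open>t / m = 4 * L\<close>, so \<open>m * (t / m) ^ 8 = 4 ^ 8 * L ^ 10\<close>,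
  the same order in \<open>L\<close> as both earlier bounds. The constants are
  \<open>1 / 32 ^ 8 = 1 / (8 ^ 8 * 4 ^ 8)\<close>, below the available
  \<open>1 / (8 ^ 7 * 4 ^ 8)\<close>, and \<open>1\<close>, above \<open>5 / 4 ^ 8\<close>.\<close>

lemma exists_sets_growth:
  fixes L :: nat
  assumes "L \<ge> 4"
  obtains A B F G :: "rat set" where
    "finite A" "finite B" "finite F" "finite G"
    "A \<subseteq> {0<..}" "B \<subseteq> {0<..}" "F \<subseteq> {0<..}" "G \<subseteq> {0<..}"
    "card A = L ^ 2" "card B = L ^ 2"
    "card (A * F) \<le> 4 * L ^ 3" "card (B * G) \<le> 4 * L ^ 3" "card (A * B) \<le> 4 * L ^ 3"
    "1 / 32 ^ 8 * real (L ^ 2) * (real (4 * L ^ 3) / real (L ^ 2)) ^ 8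
      \<le> real (card (quotient_set (F ^ 2 * G ^ 2) (F ^ 2 * G)))"
    "real (card (quotient_set (F ^ 2 * G ^ 2) (F ^ 2 * G)))
      \<le> 1 * real (L ^ 2) * (real (4 * L ^ 3) / real (L ^ 2)) ^ 8"
proof -
  obtain A B F G :: "rat set" where sets: "finite A" "finite B" "finite F" "finite G"
    "A \<subseteq> {0<..}" "B \<subseteq> {0<..}" "F \<subseteq> {0<..}" "G \<subseteq> {0<..}"
    "card A = L ^ 2" "card B = L ^ 2"
    "card (A * F) \<le> 4 * L ^ 3" "card (B * G) \<le> 4 * L ^ 3" "card (A * B) \<le> 4 * L ^ 3"
    and lower: "L ^ 3 * (L div 4) ^ 7 \<le> card (quotient_set (F ^ 2 * G ^ 2) (F ^ 2 * G))"
      (is "_ \<le> ?N")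
    and upper: "card (quotient_set (F ^ 2 * G ^ 2) (F ^ 2 * G)) \<le> 5 * L ^ 10"
    by (rule exists_rat_sets[OF assms])
  have main: "real (L ^ 2) * (real (4 * L ^ 3) / real (L ^ 2)) ^ 8 = 4 ^ 8 * real L ^ 10"
    using assms by (simp add: field_simps flip: power_add power_mult)
  \<comment> \<open>Rounding down loses at most a factor 2, because
    \<open>L div 4 \<ge> 1\<close>.\<close>
  have "L \<le> 8 * (L div 4)"
    using assms by presburger
  then have "real L / 8 \<le> real (L div 4)"
    by linarith
  then have "real L ^ 3 * (real L / 8) ^ 7 \<le> real L ^ 3 * real (L div 4) ^ 7"
    by (intro mult_left_mono power_mono) auto
  also have "\<dots> \<le> real ?N"
    using lower by (simp flip: of_nat_power of_nat_mult)
  finally have "1 / 8 ^ 7 * real L ^ 10 \<le> real ?N"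
    by (simp add: power_divide flip: power_add)
  moreover have "1 / 32 ^ 8 * (4 ^ 8 * real L ^ 10) \<le> 1 / 8 ^ 7 * real L ^ 10"
    by simp
  ultimately have "1 / 32 ^ 8 * real (L ^ 2) * (real (4 * L ^ 3) / real (L ^ 2)) ^ 8 \<le> real ?N"
    unfolding mult.assoc main by linarith
  moreover have "real ?N \<le> 5 * real L ^ 10"
    using upper of_nat_mono[of ?N "5 * L ^ 10", where 'a = real] by simp
  then have "real ?N \<le> 1 * real (L ^ 2) * (real (4 * L ^ 3) / real (L ^ 2)) ^ 8"
    unfolding mult.assoc main by (rule order_trans) simp
  ultimately show ?thesis
    by (rule that[OF sets])
qed

section \<open>Sharpness of the exponent 8\<close>

theorem proposition2p6:
  shows "(\<exists>c C :: real. 0 < c \<and> c < C \<and>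
           (\<forall>L m t :: nat. L \<ge> 4 \<and> m = L ^ 2 \<and> t = 4 * L ^ 3 \<longrightarrow>
             (\<exists>A B F G :: rat set.
               finite A \<and> finite B \<and> finite F \<and> finite G \<and>
               A \<subseteq> {0<..} \<and> B \<subseteq> {0<..} \<and> F \<subseteq> {0<..} \<and> G \<subseteq> {0<..} \<and>
               card A = m \<and> card B = m \<and>
               card (A * F) \<le> t \<and> card (B * G) \<le> t \<and> card (A * B) \<le> t \<and>
               c * real m * (real t / real m) ^ 8
                 \<le> real (card (quotient_set (F ^ 2 * G ^ 2) (F ^ 2 * G))) \<and>
               real (card (quotient_set (F ^ 2 * G ^ 2) (F ^ 2 * G)))
                 \<le> C * real m * (real t / real m) ^ 8)))
       \<and>
         \<not> (\<exists>\<delta> K :: real. \<delta> > 0 \<and> K > 0 \<and>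
           (\<forall>(A :: rat set) B F G (t :: real) (m :: real).
             finite A \<and> finite B \<and> finite F \<and> finite G \<and>
             A \<noteq> {} \<and> B \<noteq> {} \<and> F \<noteq> {} \<and> G \<noteq> {} \<and>
             A \<subseteq> {0<..} \<and> B \<subseteq> {0<..} \<and> F \<subseteq> {0<..} \<and> G \<subseteq> {0<..} \<and>
             t \<ge> m \<and> m \<ge> 1 \<and>
             real (card (A * F)) \<le> t \<and> real (card (B * G)) \<le> t \<and> real (card (A * B)) \<le> t \<and>
             real (card A) \<ge> m \<and> real (card B) \<ge> m \<longrightarrow>
             real (card (quotient_set (F ^ 2 * G ^ 2) (F ^ 2 * G)))
               \<le> K * m * (t / m) powr (8 - \<delta>)))"
proof (intro conjI notI)
  show "\<exists>c C :: real. 0 < c \<and> c < C \<and>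
           (\<forall>L m t :: nat. L \<ge> 4 \<and> m = L ^ 2 \<and> t = 4 * L ^ 3 \<longrightarrow>
             (\<exists>A B F G :: rat set.
               finite A \<and> finite B \<and> finite F \<and> finite G \<and>
               A \<subseteq> {0<..} \<and> B \<subseteq> {0<..} \<and> F \<subseteq> {0<..} \<and> G \<subseteq> {0<..} \<and>
               card A = m \<and> card B = m \<and>
               card (A * F) \<le> t \<and> card (B * G) \<le> t \<and> card (A * B) \<le> t \<and>
               c * real m * (real t / real m) ^ 8
                 \<le> real (card (quotient_set (F ^ 2 * G ^ 2) (F ^ 2 * G))) \<and>
               real (card (quotient_set (F ^ 2 * G ^ 2) (F ^ 2 * G)))
                 \<le> C * real m * (real t / real m) ^ 8))"
  proof (rule exI[of _ "1 / 32 ^ 8"], rule exI[of _ 1], intro conjI allI impI; (elim conjE)?)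
    fix L m t :: nat
    assume "L \<ge> 4" and mt: "m = L ^ 2" "t = 4 * L ^ 3"
    show "\<exists>A B F G :: rat set.
               finite A \<and> finite B \<and> finite F \<and> finite G \<and>
               A \<subseteq> {0<..} \<and> B \<subseteq> {0<..} \<and> F \<subseteq> {0<..} \<and> G \<subseteq> {0<..} \<and>
               card A = m \<and> card B = m \<and>
               card (A * F) \<le> t \<and> card (B * G) \<le> t \<and> card (A * B) \<le> t \<and>
               1 / 32 ^ 8 * real m * (real t / real m) ^ 8
                 \<le> real (card (quotient_set (F ^ 2 * G ^ 2) (F ^ 2 * G))) \<and>
               real (card (quotient_set (F ^ 2 * G ^ 2) (F ^ 2 * G)))
                 \<le> 1 * real m * (real t / real m) ^ 8"
      unfolding mt by (rule exists_sets_growth[OF \<open>L \<ge> 4\<close>]) blast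
  qed simp_all
next
  assume "\<exists>\<delta> K :: real. \<delta> > 0 \<and> K > 0 \<and>
           (\<forall>(A :: rat set) B F G (t :: real) (m :: real).
             finite A \<and> finite B \<and> finite F \<and> finite G \<and>
             A \<noteq> {} \<and> B \<noteq> {} \<and> F \<noteq> {} \<and> G \<noteq> {} \<and>
             A \<subseteq> {0<..} \<and> B \<subseteq> {0<..} \<and> F \<subseteq> {0<..} \<and> G \<subseteq> {0<..} \<and>
             t \<ge> m \<and> m \<ge> 1 \<and>
             real (card (A * F)) \<le> t \<and> real (card (B * G)) \<le> t \<and> real (card (A * B)) \<le> t \<and>
             real (card A) \<ge> m \<and> real (card B) \<ge> m \<longrightarrow>
             real (card (quotient_set (F ^ 2 * G ^ 2) (F ^ 2 * G)))
               \<le> K * m * (t / m) powr (8 - \<delta>))"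
  then obtain \<delta> K :: real where "\<delta> > 0" "K > 0" and bound:
    "\<And>(A :: rat set) B F G (t :: real) (m :: real).
       finite A \<Longrightarrow> finite B \<Longrightarrow> finite F \<Longrightarrow> finite G \<Longrightarrow>
       A \<noteq> {} \<Longrightarrow> B \<noteq> {} \<Longrightarrow> F \<noteq> {} \<Longrightarrow> G \<noteq> {} \<Longrightarrow>
       A \<subseteq> {0<..} \<Longrightarrow> B \<subseteq> {0<..} \<Longrightarrow> F \<subseteq> {0<..} \<Longrightarrow> G \<subseteq> {0<..} \<Longrightarrow>
       t \<ge> m \<Longrightarrow> m \<ge> 1 \<Longrightarrow>
       real (card (A * F)) \<le> t \<Longrightarrow> real (card (B * G)) \<le> t \<Longrightarrow> real (card (A * B)) \<le> t \<Longrightarrow>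
       real (card A) \<ge> m \<Longrightarrow> real (card B) \<ge> m \<Longrightarrow>
       real (card (quotient_set (F ^ 2 * G ^ 2) (F ^ 2 * G))) \<le> K * m * (t / m) powr (8 - \<delta>)"
    by metis
  \<comment> \<open>Since \<open>t / m = 4 * L\<close>, the assumed bound forces
    \<open>(4 * L) powr \<delta> \<le> 32 ^ 8 * K\<close>. The threshold \<open>r\<close> satisfies
    \<open>r powr \<delta> = 32 ^ 8 * K + 1\<close>, so any \<open>L \<ge> r\<close> contradicts
    this.\<close>
  define r where "r = (32 ^ 8 * K + 1) powr (1 / \<delta>)"
  obtain L :: nat where L: "real L \<ge> max 4 r"
    using real_arch_simple by blast
  then have L4: "L \<ge> 4"
    by simp
  obtain A B F G :: "rat set" where sets:
    "finite A" "finite B" "finite F" "finite G"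
    "A \<subseteq> {0<..}" "B \<subseteq> {0<..}" "F \<subseteq> {0<..}" "G \<subseteq> {0<..}"
    "card A = L ^ 2" "card B = L ^ 2"
    "card (A * F) \<le> 4 * L ^ 3" "card (B * G) \<le> 4 * L ^ 3" "card (A * B) \<le> 4 * L ^ 3"
    and lower: "1 / 32 ^ 8 * real (L ^ 2) * (real (4 * L ^ 3) / real (L ^ 2)) ^ 8
      \<le> real (card (quotient_set (F ^ 2 * G ^ 2) (F ^ 2 * G)))" (is "_ \<le> real ?N")
    by (rule exists_sets_growth[OF L4])
  have ratio: "real (4 * L ^ 3) / real (L ^ 2) = 4 * real L"
    using L4 by (simp add: field_simps power3_eq_cube power2_eq_square)
  \<comment> \<open>The assumed bound applies only to nonempty sets; a positive lower bound on
    \<open>?N\<close> rules out empty \<open>F\<close> or \<open>G\<close>.\<close>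
  have "0 < 1 / 32 ^ 8 * real (L ^ 2) * (4 * real L) ^ 8"
    using L4 by simp
  then have "?N \<noteq> 0"
    using lower unfolding ratio by linarith
  then have "F \<noteq> {}" "G \<noteq> {}"
    by (auto simp: quotient_set_def set_times_def power2_eq_square)
  moreover have "A \<noteq> {}" "B \<noteq> {}"
    using sets(9,10) L4 by auto
  moreover have "L ^ 2 \<le> 4 * L ^ 3"
    using L4 by (simp add: power3_eq_cube power2_eq_square)
  then have "real (L ^ 2) \<le> real (4 * L ^ 3)"
    by (rule of_nat_mono)
  moreover have "1 \<le> real (L ^ 2)"
    using L4 by simp
  ultimately have "real ?N \<le> K * real (L ^ 2) * (real (4 * L ^ 3) / real (L ^ 2)) powr (8 - \<delta>)"
    using sets by (intro bound[of A B F G]) (simp_all only: of_nat_le_iff order_refl not_False_eq_True)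
  then have "real (L ^ 2) * (1 / 32 ^ 8 * (4 * real L) ^ 8)
      \<le> real (L ^ 2) * (K * (4 * real L) powr (8 - \<delta>))"
    using lower unfolding ratio by (simp only: mult_ac)
  then have "1 / 32 ^ 8 * (4 * real L) ^ 8 \<le> K * (4 * real L) powr (8 - \<delta>)"
    by (rule mult_left_le_imp_le) (use L4 in simp)
  then have "(4 * real L) ^ 8 \<le> 32 ^ 8 * K * (4 * real L) powr (8 - \<delta>)"
    by simp
  \<comment> \<open>Splitting off the exponent \<open>\<delta>\<close> lets the common factor with
    exponent \<open>8 - \<delta>\<close> cancel, whatever the sign of
    \<open>8 - \<delta>\<close>.\<close>
  moreover have "(4 * real L) ^ 8 = (4 * real L) powr \<delta> * (4 * real L) powr (8 - \<delta>)"
    using L4 by (simp flip: powr_add)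
  ultimately have "(4 * real L) powr \<delta> * (4 * real L) powr (8 - \<delta>)
      \<le> 32 ^ 8 * K * (4 * real L) powr (8 - \<delta>)"
    by (simp only:)
  then have "(4 * real L) powr \<delta> \<le> 32 ^ 8 * K"
    by (rule mult_right_le_imp_le) (use L4 in simp)
  moreover have "32 ^ 8 * K + 1 = r powr \<delta>"
    using \<open>\<delta> > 0\<close> \<open>K > 0\<close> by (simp add: r_def powr_powr)
  moreover have "r powr \<delta> \<le> (4 * real L) powr \<delta>"
    using L \<open>\<delta> > 0\<close> by (intro powr_mono2) (auto simp: r_def)
  ultimately show False
    by linarith
qed

end
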